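(* Fix the balance parameter $p \in (0,1)$, the number $r$ of vertices (a positive integer), and the dimension $n$ (a positive integer). Draw a random set $F$ from the distribution $\mathrm{Face}(p, r, n)$. Then $$ \mathbb{P}\left\{ F \text{ is a simplicial face of } \mathcal{E}_n \text{ with dimension } r-1 \right\} \;\geq\; 1 - r^2 \exp\left( \frac{-4p^2(1-p)^2 n}{r^2} \right). $$
   Context: The elliptope $\mathcal{E}_n$ is the convex set of all $n \times n$ real symmetric positive-semidefinite matrices whose diagonal entries are all equal to one. The signed Bernoulli distribution $\mathrm{SBern}(p)$ with parameter $p \in [0,1]$ takes the value $+1$ with probability $p$ and the value $-1$ with probability $1-p$. A random vector with distribution $\mathrm{SBern}(p,n)$ takes values in $\{\pm 1\}^n$ and has $n$ independent entries, each with distribution $\mathrm{SBern}(p)$. The random model $\mathrm{Face}(p,r,n)$: draw (column) random vectors $\boldsymbol{\xi}_1, \dots, \boldsymbol{\xi}_r$ independently from $\mathrm{SBern}(p,n)$ and set $$F := \operatorname{conv}\{ \boldsymbol{\xi}_1 \boldsymbol{\xi}_1^{\mathsf{t}}, \dots, \boldsymbol{\xi}_r \boldsymbol{\xi}_r^{\mathsf{t}} \} \subset \mathcal{E}_n,$$ where ${}^{\mathsf{t}}$ is the transpose and $\operatorname{conv}$ the convex hull. The dimension of a convex set is the dimension of its affine hull. A face $F$ of a convex set $K$ is a convex subset of $K$ such that whenever $x, y \in K$ and $\theta x + (1-\theta) y \in F$ for some $\theta \in (0,1)$, it follows that $x, y \in F$. A $k$-dimensional face of a convex set is simplicial if it is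 the convex hull of an affinely independent family of $k+1$ points. *)

theory Defs
  imports "HOL-Analysis.Analysis" "HOL-Probability.Probability"
begin

definition pos_semidef :: "real ^ 'n ^ 'n \<Rightarrow> bool" where
  "pos_semidef X \<longleftrightarrow> transpose X = X \<and> (\<forall>v. 0 \<le> v \<bullet> (X *v v))"

definition elliptope :: "(real ^ 'n ^ 'n) set" where
  "elliptope = {X. pos_semidef X \<and> (\<forall>i. X $ i $ i = 1)}"

definition simplicial_face :: "'a::euclidean_space set \<Rightarrow> 'a set \<Rightarrow> bool" where
  "simplicial_face F K \<longleftrightarrow> F face_of K \<and> (aff_dim F) simplex F"

definition outer :: "real ^ 'n \<Rightarrow> real ^ 'n ^ 'n" where
  "outer x = (\<chi> i j. x $ i * x $ j)"

definition SBern :: "real \<Rightarrow> real pmf" where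
  "SBern p = map_pmf (\<lambda>b. if b then 1 else -1) (bernoulli_pmf p)"

text \<open>The dimension \<open>n\<close> is the cardinality of the index type. The second
  argument of \<^const>\<open>Pi_pmf\<close> is only the value taken outside the index set; it is
  irrelevant here and in the definition of the random face.\<close>

definition SBern_vec :: "real \<Rightarrow> (real ^ 'n) pmf" where
  "SBern_vec p = map_pmf vec_lambda (Pi_pmf UNIV 0 (\<lambda>_. SBern p))"

definition random_face :: "real \<Rightarrow> nat \<Rightarrow> (real ^ 'n ^ 'n) set pmf" where
  "random_face p r =
     map_pmf (\<lambda>\<xi>. convex hull ((\<lambda>k. outer (\<xi> k)) ` {1..r}))
       (Pi_pmf {1..r} 0 (\<lambda>_. SBern_vec p))"

end

theory Submission imports Defs begin

text \<open>
  Call the sign vectors \<open>\<xi>\<^sub>1, \<dots>, \<xi>\<^sub>r\<close> Schur independent if the all-ones vector and the entrywise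
  products \<open>\<xi>\<^sub>k \<circ> \<xi>\<^sub>l\<close> with \<open>k < l\<close> are linearly independent. The proof combines a deterministic
  criterion with a lower bound for the probability of Schur independence.

  Criterion (\<open>schur_independent_imp_simplicial_face\<close>). If a convex combination of two matrices of
  the elliptope lies in the hull of the \<open>\<xi>\<^sub>k \<xi>\<^sub>k\<^sup>t\<close>, then positivity forces both matrices to
  annihilate the orthogonal complement of the \<open>\<xi>\<^sub>k\<close>. Each is thus of the form
  \<open>\<Sum>\<^sub>k\<^sub>,\<^sub>l Y\<^sub>k\<^sub>l \<xi>\<^sub>k \<xi>\<^sub>l\<^sup>t\<close> with \<open>Y\<close> positive semidefinite, and comparing diagonals gives
  \<open>(\<Sum>\<^sub>k Y\<^sub>k\<^sub>k) 1 + 2 \<Sum>\<^sub>k\<^sub><\<^sub>l Y\<^sub>k\<^sub>l \<xi>\<^sub>k \<circ> \<xi>\<^sub>l = 1\<close>. By Schur independence \<open>Y\<close> is diagonal with trace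
  one, so both matrices are in the hull, which is therefore a face. The \<open>\<xi>\<^sub>k \<xi>\<^sub>k\<^sup>t\<close> are also linearly
  independent, so the face is a simplex of dimension \<open>r - 1\<close>.

  Probability (\<open>prob_vanishing_quadratic\<close>). Read by rows, the data are \<open>n\<close> independent vectors of
  \<open>r\<close> random signs, and Schur independence fails exactly if a nonzero quadratic form
  \<open>a + \<Sum>\<^sub>k\<^sub><\<^sub>l c\<^sub>k\<^sub>l x\<^sub>k x\<^sub>l\<close> vanishes at all \<open>n\<close> of them. Any nonzero form is nonzero at a random sign
  vector with probability at least \<open>u = p\<^sup>2 (1 - p)\<^sup>2\<close> (\<open>prob_quadratic_nonzero\<close>). So while the space
  of forms vanishing at the rows seen so far is nontrivial, each new row lowers its dimension \<open>d\<close>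
  with conditional probability at least \<open>u\<close>. A supermartingale argument with the weight
  \<open>s ^ (1 - d)\<close> for \<open>d \<ge> 1\<close>, and \<open>0\<close> for \<open>d = 0\<close>, bounds the probability that the space is still
  nontrivial after \<open>n\<close> rows by \<open>s ^ (- r (r - 1) / 2) (1 - u (1 - s)) ^ n\<close>
  (\<open>prob_vanishing_combination\<close>). For \<open>r \<ge> 3\<close> and \<open>s = 1 - 4 / r\<^sup>2\<close> the second factor is at most
  \<open>exp (- 4 u n / r\<^sup>2)\<close> and the first is at most \<open>r\<^sup>2\<close>. The cases \<open>r = 1\<close> and \<open>r = 2\<close> follow from the
  same bound with another \<open>s\<close> and a better estimate of the probability that a form is nonzero.
\<close>

section \<open>Schur products and independent families\<close>

definition pairs :: "nat \<Rightarrow> (nat \<times> nat) set" where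
  "pairs r = (SIGMA l:{1..r}. {1..<l})"

text \<open>
  The constant \<open>1\<close> is represented by \<open>x\<^sub>1 * x\<^sub>1\<close>, which equals it on sign vectors,
  so that constant and off-diagonal terms have one uniform description.
\<close>

definition monomials :: "nat \<Rightarrow> (nat \<times> nat) set" where
  "monomials r = insert (1, 1) (pairs r)"

text \<open>
  Linear independence of the all-ones vector and of the entrywise (Schur) products
  \<open>\<xi>\<^sub>l \<circ> \<xi>\<^sub>k\<close> with \<open>k < l\<close>; the entries of \<open>\<xi>\<^sub>1 \<circ> \<xi>\<^sub>1\<close> are all \<open>1\<close> for sign vectors.
\<close>

definition schur_independent :: "nat \<Rightarrow> (nat \<Rightarrow> real ^ 'n) \<Rightarrow> bool" where
  "schur_independent r \<xi> \<longleftrightarrow>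
     (\<forall>c. (\<forall>i. (\<Sum>m\<in>monomials r. c m * (\<xi> (fst m) $ i * \<xi> (snd m) $ i)) = 0)
          \<longrightarrow> (\<forall>m\<in>monomials r. c m = 0))"

definition sign_vectors :: "nat \<Rightarrow> (nat \<Rightarrow> real ^ 'n) \<Rightarrow> bool" where
  "sign_vectors r \<xi> \<longleftrightarrow> (\<forall>k\<in>{1..r}. \<forall>i. \<xi> k $ i = 1 \<or> \<xi> k $ i = -1)"

lemma finite_pairs [simp]: "finite (pairs r)"
  by (simp add: pairs_def)

lemma finite_monomials [simp]: "finite (monomials r)"
  by (simp add: monomials_def)

lemma sum_pairs: "(\<Sum>m\<in>pairs r. f m) = (\<Sum>l\<in>{1..r}. \<Sum>k\<in>{1..<l}. f (l, k))"
  by (simp add: pairs_def sum.Sigma)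

lemma double_sum_split_pairs:
  fixes g :: "nat \<Rightarrow> nat \<Rightarrow> 'a::comm_monoid_add"
  shows "(\<Sum>k\<in>{1..r}. \<Sum>l\<in>{1..r}. g k l)
       = (\<Sum>k\<in>{1..r}. g k k) + (\<Sum>m\<in>pairs r. g (fst m) (snd m) + g (snd m) (fst m))"
  unfolding sum_pairs
proof (induction r)
  case (Suc r)
  have "(\<Sum>k\<in>{1..Suc r}. \<Sum>l\<in>{1..Suc r}. g k l)
      = (\<Sum>k\<in>{1..r}. \<Sum>l\<in>{1..r}. g k l) + (\<Sum>k\<in>{1..r}. g k (Suc r))
        + ((\<Sum>l\<in>{1..r}. g (Suc r) l) + g (Suc r) (Suc r))"
    by (simp add: sum.distrib ac_simps)
  also have "(\<Sum>k\<in>{1..r}. \<Sum>l\<in>{1..r}. g k l) = (\<Sum>k\<in>{1..r}. g k k)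
      + (\<Sum>l\<in>{1..r}. \<Sum>k\<in>{1..<l}. g l k + g k l)"
    using Suc by simp
  finally show ?case
    by (simp add: sum.distrib atLeastLessThanSuc_atLeastAtMost add.assoc)
       (simp add: add.left_commute add.commute)
qed simp

lemma schur_independentD:
  fixes \<xi> :: "nat \<Rightarrow> real ^ 'n"
  assumes "schur_independent r \<xi>" "sign_vectors r \<xi>" "1 \<le> r"
    and rel: "\<And>i. a + (\<Sum>m\<in>pairs r. c m * (\<xi> (fst m) $ i * \<xi> (snd m) $ i)) = 0"
  shows "a = 0" and "m \<in> pairs r \<Longrightarrow> c m = 0"
proof -
  define c' where "c' = c((1, 1) := a)"
  have no: "(1, 1) \<notin> pairs r" by (auto simp: pairs_def)
  have "(\<Sum>m\<in>monomials r. c' m * (\<xi> (fst m) $ i * \<xi> (snd m) $ i)) = 0" for i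
  proof -
    have "\<xi> 1 $ i * \<xi> 1 $ i = 1"
      using assms(2,3) by (auto simp: sign_vectors_def dest!: bspec[of _ _ 1] spec[of _ i])
    moreover have "(\<Sum>m\<in>pairs r. c' m * (\<xi> (fst m) $ i * \<xi> (snd m) $ i))
        = (\<Sum>m\<in>pairs r. c m * (\<xi> (fst m) $ i * \<xi> (snd m) $ i))"
      using no by (intro sum.cong) (auto simp: c'_def)
    ultimately show ?thesis
      using rel[of i] no by (simp add: monomials_def c'_def)
  qed
  then have all: "\<forall>m\<in>monomials r. c' m = 0"
    using assms(1) by (simp add: schur_independent_def)
  show "a = 0" using all by (simp add: monomials_def c'_def)
  show "c m = 0" if "m \<in> pairs r"
    using all that no by (auto simp: monomials_def c'_def split: if_splits)
qed

text \<open>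
  A linear relation among the vectors, multiplied entrywise by \<open>\<xi>\<^sub>m\<close>, is a relation among
  the Schur products in which the coefficient of \<open>\<xi>\<^sub>m\<close> has become the constant term.
\<close>

lemma schur_independent_imp_independent:
  fixes \<xi> :: "nat \<Rightarrow> real ^ 'n"
  assumes "schur_independent r \<xi>" "sign_vectors r \<xi>" "1 \<le> r"
    and rel: "\<And>i. (\<Sum>k\<in>{1..r}. b k * \<xi> k $ i) = 0" and m: "m \<in> {1..r}"
  shows "b m = 0"
proof (rule schur_independentD(1)[OF assms(1-3)])
  define c where "c q = (if snd q = m then b (fst q) else 0) + (if fst q = m then b (snd q) else 0)"
    for q :: "nat \<times> nat"
  fix i
  define g where "g k l = (if l = m then b k * (\<xi> k $ i * \<xi> m $ i) else 0)" for k l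
  have sq: "\<xi> m $ i * \<xi> m $ i = 1"
    using assms(2) m by (auto simp: sign_vectors_def dest!: bspec[of _ _ m] spec[of _ i])
  have "0 = (\<Sum>k\<in>{1..r}. b k * \<xi> k $ i) * \<xi> m $ i" using rel by simp
  also have "\<dots> = (\<Sum>k\<in>{1..r}. \<Sum>l\<in>{1..r}. g k l)"
    using m by (simp add: g_def sum_distrib_right mult.assoc)
  also have "\<dots> = (\<Sum>k\<in>{1..r}. g k k)
      + (\<Sum>q\<in>pairs r. g (fst q) (snd q) + g (snd q) (fst q))"
    by (rule double_sum_split_pairs)
  also have "(\<Sum>k\<in>{1..r}. g k k) = b m"
    using m sq by (simp add: g_def if_distrib cong: if_cong)
  also have "(\<Sum>q\<in>pairs r. g (fst q) (snd q) + g (snd q) (fst q))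
      = (\<Sum>q\<in>pairs r. c q * (\<xi> (fst q) $ i * \<xi> (snd q) $ i))"
    by (intro sum.cong) (auto simp: g_def c_def algebra_simps)
  finally show "b m + (\<Sum>q\<in>pairs r. c q * (\<xi> (fst q) $ i * \<xi> (snd q) $ i)) = 0" by simp
qed

lemma independent_family_inj:
  fixes \<xi> :: "'i \<Rightarrow> 'a::real_vector"
  assumes fin: "finite I"
    and indep: "\<And>b l. (\<Sum>k\<in>I. b k *\<^sub>R \<xi> k) = 0 \<Longrightarrow> l \<in> I \<Longrightarrow> b l = 0"
  shows "inj_on \<xi> I"
proof (rule inj_onI, rule ccontr)
  fix j k assume jk: "j \<in> I" "k \<in> I" "\<xi> j = \<xi> k" "j \<noteq> k"
  have "(\<Sum>i\<in>I. ((if i = j then 1 else 0) - (if i = k then 1 else 0 :: real)) *\<^sub>R \<xi> i) = 0"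
    using jk fin by (simp add: scaleR_diff_left sum_subtractf if_distrib[of "\<lambda>c. c *\<^sub>R _"] cong: if_cong)
  from indep[OF this jk(1)] jk(4) show False by simp
qed

text \<open>
  By independence \<open>\<xi>\<^sub>l\<close> is outside the span of the other vectors, so the span of the whole
  family contains a nonzero vector orthogonal to these others. It cannot be orthogonal to
  \<open>\<xi>\<^sub>l\<close> as well, since it lies in the span of the family; rescaled, it is dual to \<open>\<xi>\<^sub>l\<close>.
\<close>

lemma independent_family_has_dual:
  fixes \<xi> :: "'i \<Rightarrow> 'a::euclidean_space"
  assumes fin: "finite I"
    and indep: "\<And>b l. (\<Sum>k\<in>I. b k *\<^sub>R \<xi> k) = 0 \<Longrightarrow> l \<in> I \<Longrightarrow> b l = 0"
  obtains w where "\<And>k l. k \<in> I \<Longrightarrow> l \<in> I \<Longrightarrow> \<xi> k \<bullet> w l = (if k = l then 1 else 0)"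
proof -
  have "\<exists>v. \<forall>k\<in>I. \<xi> k \<bullet> v = (if k = l then 1 else 0)" if l: "l \<in> I" for l
  proof -
    have inj: "inj_on \<xi> I" using fin indep by (rule independent_family_inj)
    have notin: "\<xi> l \<notin> span (\<xi> ` (I - {l}))"
    proof
      assume "\<xi> l \<in> span (\<xi> ` (I - {l}))"
      then obtain u where "\<xi> l = (\<Sum>v\<in>\<xi> ` (I - {l}). u v *\<^sub>R v)"
        using fin by (auto simp: span_finite)
      also have "\<dots> = (\<Sum>k\<in>I - {l}. u (\<xi> k) *\<^sub>R \<xi> k)"
        by (rule sum.reindex_cong[OF inj_on_subset[OF inj]]) auto
      finally have e: "\<xi> l = (\<Sum>k\<in>I - {l}. u (\<xi> k) *\<^sub>R \<xi> k)" .
      have "(\<Sum>k\<in>I. (if k = l then -1 else u (\<xi> k)) *\<^sub>R \<xi> k)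
          = - \<xi> l + (\<Sum>k\<in>I - {l}. u (\<xi> k) *\<^sub>R \<xi> k)"
        using fin l by (subst sum.remove[of _ l]) (auto intro!: sum.cong)
      also have "\<dots> = 0" using e by simp
      finally show False using indep[OF _ l] by fastforce
    qed
    then have "span (\<xi> ` (I - {l})) \<subset> span (\<xi> ` I)"
      using l by (metis Diff_subset image_mono imageI psubsetI span_base span_mono)
    then obtain v where v: "v \<noteq> 0" "v \<in> span (\<xi> ` I)"
        "\<And>y. y \<in> span (\<xi> ` (I - {l})) \<Longrightarrow> orthogonal v y"
      using orthogonal_to_subspace_exists_gen by metis
    have other: "\<xi> k \<bullet> v = 0" if "k \<in> I" "k \<noteq> l" for k
      using v(3)[of "\<xi> k"] that by (simp add: orthogonal_def span_base inner_commute)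
    have "\<xi> l \<bullet> v \<noteq> 0"
    proof
      assume "\<xi> l \<bullet> v = 0"
      then have "\<forall>y\<in>\<xi> ` I. orthogonal v y"
        using other by (auto simp: orthogonal_def inner_commute)
      then have "orthogonal v v"
        using v(2) by (metis orthogonal_to_span)
      then show False using v(1) by (simp add: orthogonal_def)
    qed
    then have "\<forall>k\<in>I. \<xi> k \<bullet> (v /\<^sub>R (\<xi> l \<bullet> v)) = (if k = l then 1 else 0)"
      using other by auto
    then show ?thesis by blast
  qed
  then obtain w where "\<forall>l\<in>I. \<forall>k\<in>I. \<xi> k \<bullet> w l = (if k = l then 1 else 0)"
    by metis
  then show ?thesis using that by blast
qed

section \<open>Schur independence and faces of the elliptope\<close>

lemma outer_mult_vec: "outer x *v v = (x \<bullet> v) *\<^sub>R x"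
  by (simp add: vec_eq_iff outer_def matrix_vector_mult_def inner_vec_def sum_distrib_left
      sum_distrib_right mult_ac)

lemma symmetric_matrix_inner:
  fixes X :: "real ^ 'n ^ 'n"
  assumes "transpose X = X"
  shows "v \<bullet> (X *v u) = (X *v v) \<bullet> u"
  by (metis assms dot_lmul_matrix transpose_matrix_vector)

text \<open>
  The form is nonnegative along the line \<open>v + t u\<close> with \<open>u = X v\<close>, where it equals
  \<open>2 t |u|\<^sup>2 + t\<^sup>2 (u \<bullet> X u)\<close>; for small negative \<open>t\<close> the linear term would win unless \<open>u = 0\<close>.
\<close>

lemma pos_semidef_kernel:
  fixes X :: "real ^ 'n ^ 'n"
  assumes X: "pos_semidef X" and v: "v \<bullet> (X *v v) = 0"
  shows "X *v v = 0"
proof -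
  define u where "u = X *v v"
  have sym: "transpose X = X" using X by (simp add: pos_semidef_def)
  have "v \<bullet> (X *v u) = u \<bullet> u" "u \<bullet> (X *v v) = u \<bullet> u"
    using symmetric_matrix_inner[OF sym, of v u] by (simp_all add: u_def)
  then have ge: "0 \<le> t * (2 * (u \<bullet> u) + t * (u \<bullet> (X *v u)))" for t
    using X v unfolding pos_semidef_def
    by (auto dest!: spec[of _ "v + t *\<^sub>R u"] simp: matrix_vector_right_distrib
        inner_add_left inner_add_right matrix_vector_mult_scaleR algebra_simps)
  have "u \<bullet> u = 0"
  proof (rule ccontr)
    assume "u \<bullet> u \<noteq> 0"
    then have pos: "0 < u \<bullet> u" by (simp add: order_less_le)
    define q where "q = \<bar>u \<bullet> (X *v u)\<bar> + 1"
    define t where "t = - (u \<bullet> u) / q"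
    have q: "q > 0" "u \<bullet> (X *v u) \<ge> - q" by (auto simp: q_def)
    have "t < 0" using pos q by (simp add: t_def divide_less_0_iff)
    moreover have "t * (u \<bullet> (X *v u)) \<ge> t * q"
      using \<open>t < 0\<close> by (intro mult_left_mono_neg) (auto simp: q_def)
    moreover have "t * q = - (u \<bullet> u)" using q by (simp add: t_def)
    ultimately have "t * (2 * (u \<bullet> u) + t * (u \<bullet> (X *v u))) < 0"
      using pos by (intro mult_neg_pos) linarith+
    then show False using ge[of t] by simp
  qed
  then show ?thesis by (simp add: u_def)
qed

lemma convex_elliptope: "convex (elliptope :: (real ^ 'n ^ 'n) set)"
proof (rule convexI)
  fix X Y :: "real ^ 'n ^ 'n" and a b :: real
  assume *: "X \<in> elliptope" "Y \<in> elliptope" "0 \<le> a" "0 \<le> b" "a + b = 1"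
  then have "\<And>v. 0 \<le> v \<bullet> ((a *\<^sub>R X + b *\<^sub>R Y) *v v)"
    by (simp add: elliptope_def pos_semidef_def matrix_vector_mult_add_rdistrib
        scaleR_matrix_vector_assoc[symmetric] inner_add_right)
  moreover have "transpose (a *\<^sub>R X + b *\<^sub>R Y) = a *\<^sub>R X + b *\<^sub>R Y"
    using * by (simp add: elliptope_def pos_semidef_def transpose_def vec_eq_iff)
  ultimately show "a *\<^sub>R X + b *\<^sub>R Y \<in> elliptope"
    using * by (simp add: elliptope_def pos_semidef_def)
qed

lemma outer_in_elliptope:
  assumes "\<And>i. x $ i = 1 \<or> x $ i = -1"
  shows "outer x \<in> elliptope"
proof -
  have "x $ i * x $ i = 1" for i using assms[of i] by auto
  then show ?thesis
    by (simp add: elliptope_def pos_semidef_def outer_mult_vec inner_commute)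
       (simp add: outer_def transpose_def vec_eq_iff mult.commute)
qed

lemma convex_hull_indexed:
  assumes "finite I" "\<And>k. k \<in> I \<Longrightarrow> 0 \<le> a k" "(\<Sum>k\<in>I. a k) = 1"
  shows "(\<Sum>k\<in>I. a k *\<^sub>R f k) \<in> convex hull (f ` I)"
  by (rule convex_sum) (use assms in \<open>auto intro: hull_inc\<close>)

text \<open>
  Expanding the quadratic form of \<open>X\<close> in a family dual to the \<open>\<xi>\<^sub>k\<close> gives
  \<open>X = \<Sum>\<^sub>k\<^sub>,\<^sub>l Y\<^sub>k\<^sub>l \<xi>\<^sub>k \<xi>\<^sub>l\<^sup>t\<close> with \<open>Y\<close> positive semidefinite. The unit diagonal of \<open>X\<close> is then a linear
  relation between the all-ones vector and the Schur products. Schur independence makes it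
  trivial: \<open>Y\<close> is diagonal of trace \<open>1\<close>, which exhibits \<open>X\<close> as a convex combination.
\<close>

lemma elliptope_supported_on_span:
  fixes \<xi> :: "nat \<Rightarrow> real ^ 'n"
  assumes indep: "schur_independent r \<xi>" and sgn: "sign_vectors r \<xi>" and r: "1 \<le> r"
    and X: "X \<in> elliptope"
    and ker: "\<And>v. (\<And>k. k \<in> {1..r} \<Longrightarrow> \<xi> k \<bullet> v = 0) \<Longrightarrow> X *v v = 0"
  shows "X \<in> convex hull ((\<lambda>k. outer (\<xi> k)) ` {1..r})"
proof -
  have sym: "transpose X = X" and psd: "\<And>v. 0 \<le> v \<bullet> (X *v v)" and diag: "\<And>i. X $ i $ i = 1"
    using X by (auto simp: elliptope_def pos_semidef_def)
  have "b l = 0" if "(\<Sum>k\<in>{1..r}. b k *\<^sub>R \<xi> k) = 0" "l \<in> {1..r}" for b l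
    using that
    by (intro schur_independent_imp_independent[OF indep sgn r, of b l])
       (auto simp: vec_eq_iff)
  then obtain w where w: "\<And>k l. k \<in> {1..r} \<Longrightarrow> l \<in> {1..r} \<Longrightarrow> \<xi> k \<bullet> w l = (if k = l then 1 else 0)"
    by (rule independent_family_has_dual[OF finite_atLeastAtMost, where \<xi>=\<xi>]) blast+
  define Y where "Y k l = w k \<bullet> (X *v w l)" for k l
  have Ysym: "Y k l = Y l k" for k l
    unfolding Y_def using symmetric_matrix_inner[OF sym] by (simp add: inner_commute)
  have Xv: "X *v v = (\<Sum>k\<in>{1..r}. (\<xi> k \<bullet> v) *\<^sub>R (X *v w k))" for v
  proof -
    have "\<xi> k \<bullet> (v - (\<Sum>l\<in>{1..r}. (\<xi> l \<bullet> v) *\<^sub>R w l)) = 0" if "k \<in> {1..r}" for k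
    proof -
      have "(\<Sum>l\<in>{1..r}. (\<xi> l \<bullet> v) * (\<xi> k \<bullet> w l))
          = (\<Sum>l\<in>{1..r}. if l = k then \<xi> k \<bullet> v else 0)"
        by (rule sum.cong) (use that w in auto)
      then show ?thesis using that by (simp add: inner_diff_right inner_sum_right)
    qed
    from ker[OF this] show ?thesis
      by (simp add: matrix_vector_mult_diff_distrib linear_sum[OF matrix_vector_mul_linear]
          matrix_vector_mult_scaleR)
  qed
  have form: "v \<bullet> (X *v u) = (\<Sum>k\<in>{1..r}. \<Sum>l\<in>{1..r}. Y k l * ((\<xi> k \<bullet> v) * (\<xi> l \<bullet> u)))" for v u
  proof -
    have "v \<bullet> (X *v u) = (\<Sum>l\<in>{1..r}. (\<xi> l \<bullet> u) * (v \<bullet> (X *v w l)))"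
      by (subst Xv) (simp add: inner_sum_right)
    also have "\<dots> = (\<Sum>l\<in>{1..r}. (\<xi> l \<bullet> u) * (\<Sum>k\<in>{1..r}. (\<xi> k \<bullet> v) * Y k l))"
      by (simp add: symmetric_matrix_inner[OF sym] Xv[of v] inner_sum_left Y_def)
    also have "\<dots> = (\<Sum>l\<in>{1..r}. \<Sum>k\<in>{1..r}. Y k l * ((\<xi> k \<bullet> v) * (\<xi> l \<bullet> u)))"
      by (simp add: sum_distrib_left mult_ac)
    finally show ?thesis by (subst sum.swap)
  qed
  have entry: "X $ i $ j = (\<Sum>k\<in>{1..r}. \<Sum>l\<in>{1..r}. Y k l * (\<xi> k $ i * \<xi> l $ j))" for i j
    using form[of "axis i 1" "axis j 1"]
    by (simp add: inner_axis inner_axis' matrix_vector_mul_component)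
  have one: "(\<Sum>k\<in>{1..r}. Y k k) - 1
      + (\<Sum>m\<in>pairs r. 2 * Y (fst m) (snd m) * (\<xi> (fst m) $ i * \<xi> (snd m) $ i)) = 0" for i
  proof -
    have "1 = (\<Sum>k\<in>{1..r}. \<Sum>l\<in>{1..r}. Y k l * (\<xi> k $ i * \<xi> l $ i))"
      using entry[of i i] diag by simp
    also have "\<dots> = (\<Sum>k\<in>{1..r}. Y k k * (\<xi> k $ i * \<xi> k $ i))
        + (\<Sum>m\<in>pairs r. Y (fst m) (snd m) * (\<xi> (fst m) $ i * \<xi> (snd m) $ i)
            + Y (snd m) (fst m) * (\<xi> (snd m) $ i * \<xi> (fst m) $ i))"
      by (rule double_sum_split_pairs)
    also have "(\<Sum>k\<in>{1..r}. Y k k * (\<xi> k $ i * \<xi> k $ i)) = (\<Sum>k\<in>{1..r}. Y k k)"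
      using sgn by (intro sum.cong) (auto simp: sign_vectors_def dest!: bspec spec[of _ i])
    also have "(\<Sum>m\<in>pairs r. Y (fst m) (snd m) * (\<xi> (fst m) $ i * \<xi> (snd m) $ i)
            + Y (snd m) (fst m) * (\<xi> (snd m) $ i * \<xi> (fst m) $ i))
        = (\<Sum>m\<in>pairs r. 2 * Y (fst m) (snd m) * (\<xi> (fst m) $ i * \<xi> (snd m) $ i))"
      by (intro sum.cong) (auto simp: Ysym[of "snd _"] algebra_simps)
    finally show ?thesis by simp
  qed
  have trace: "(\<Sum>k\<in>{1..r}. Y k k) = 1"
    using schur_independentD(1)[OF indep sgn r one] by simp
  have offdiag: "Y l k = 0" if "(l, k) \<in> pairs r" for l k
    using schur_independentD(2)[OF indep sgn r one that] by simp
  have "X $ i $ j = (\<Sum>k\<in>{1..r}. Y k k *\<^sub>R outer (\<xi> k)) $ i $ j" for i j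
  proof -
    have "X $ i $ j = (\<Sum>k\<in>{1..r}. Y k k * (\<xi> k $ i * \<xi> k $ j))
        + (\<Sum>m\<in>pairs r. Y (fst m) (snd m) * (\<xi> (fst m) $ i * \<xi> (snd m) $ j)
            + Y (snd m) (fst m) * (\<xi> (snd m) $ i * \<xi> (fst m) $ j))"
      unfolding entry by (rule double_sum_split_pairs)
    also have "(\<Sum>m\<in>pairs r. Y (fst m) (snd m) * (\<xi> (fst m) $ i * \<xi> (snd m) $ j)
            + Y (snd m) (fst m) * (\<xi> (snd m) $ i * \<xi> (fst m) $ j)) = 0"
      using offdiag Ysym by (intro sum.neutral) (auto simp: Ysym[of "snd _"])
    finally show ?thesis by (simp add: outer_def)
  qed
  then have "X = (\<Sum>k\<in>{1..r}. Y k k *\<^sub>R outer (\<xi> k))" by (simp add: vec_eq_iff)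
  also have "\<dots> \<in> convex hull ((\<lambda>k. outer (\<xi> k)) ` {1..r})"
    using psd trace by (intro convex_hull_indexed) (auto simp: Y_def)
  finally show ?thesis .
qed

text \<open>
  If a point of the hull lies strictly between \<open>X\<close> and \<open>Y\<close> in the elliptope, then every
  vector \<open>v\<close> orthogonal to all \<open>\<xi>\<^sub>k\<close> makes a positive combination of the nonnegative numbers
  \<open>v \<bullet> X v\<close> and \<open>v \<bullet> Y v\<close> vanish. So \<open>X\<close> and \<open>Y\<close> annihilate \<open>v\<close>, and the preceding lemma applies
  to both.
\<close>

lemma schur_independent_imp_face:
  fixes \<xi> :: "nat \<Rightarrow> real ^ 'n"
  assumes indep: "schur_independent r \<xi>" and sgn: "sign_vectors r \<xi>" and r: "1 \<le> r"
  shows "convex hull ((\<lambda>k. outer (\<xi> k)) ` {1..r}) face_of elliptope"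
    (is "?F face_of _")
proof -
  have sub: "?F \<subseteq> elliptope"
    by (rule hull_minimal)
       (use sgn in \<open>auto simp: sign_vectors_def convex_elliptope intro!: outer_in_elliptope\<close>)
  have ker: "Z *v v = 0" if Z: "Z \<in> ?F" and v: "\<And>k. k \<in> {1..r} \<Longrightarrow> \<xi> k \<bullet> v = 0" for Z v
  proof -
    have "?F \<subseteq> {Z. Z *v v = 0}"
    proof (rule hull_minimal)
      show "convex {Z :: real ^ 'n ^ 'n. Z *v v = 0}"
        by (auto simp: convex_def matrix_vector_mult_add_rdistrib scaleR_matrix_vector_assoc[symmetric])
    qed (use v in \<open>auto simp: outer_mult_vec\<close>)
    with Z show ?thesis by auto
  qed
  have endpoint: "X \<in> ?F"
    if X: "X \<in> elliptope" and Y: "Y \<in> elliptope" and Z: "(1 - t) *\<^sub>R X + t *\<^sub>R Y \<in> ?F"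
      and t: "0 < t" "t < 1" for X Y t
  proof (rule elliptope_supported_on_span[OF indep sgn r X])
    fix v assume v: "\<And>k. k \<in> {1..r} \<Longrightarrow> \<xi> k \<bullet> v = 0"
    have "v \<bullet> (((1 - t) *\<^sub>R X + t *\<^sub>R Y) *v v) = 0"
      using ker[OF Z v] by simp
    then have "(1 - t) * (v \<bullet> (X *v v)) + t * (v \<bullet> (Y *v v)) = 0"
      by (simp add: matrix_vector_mult_add_rdistrib scaleR_matrix_vector_assoc[symmetric] inner_add_right)
    moreover have "0 \<le> (1 - t) * (v \<bullet> (X *v v))" "0 \<le> t * (v \<bullet> (Y *v v))"
      using X Y t by (auto simp: elliptope_def pos_semidef_def)
    ultimately have "(1 - t) * (v \<bullet> (X *v v)) = 0" by linarith
    then have "v \<bullet> (X *v v) = 0" using t by simp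
    then show "X *v v = 0"
      using X by (intro pos_semidef_kernel) (auto simp: elliptope_def)
  qed
  show ?thesis
    unfolding face_of_def
  proof (intro conjI ballI impI sub convex_convex_hull)
    fix X Y Z assume *: "X \<in> elliptope" "Y \<in> elliptope" "Z \<in> ?F" "Z \<in> open_segment X Y"
    then obtain t where t: "0 < t" "t < 1" "Z = (1 - t) *\<^sub>R X + t *\<^sub>R Y"
      by (auto simp: in_segment)
    show "X \<in> ?F" using endpoint[of X Y t] * t by simp
    show "Y \<in> ?F" using endpoint[of Y X "1 - t"] * t by (simp add: add.commute)
  qed
qed

text \<open>
  Column \<open>j\<close> of a relation \<open>\<Sum>\<^sub>k a\<^sub>k \<xi>\<^sub>k \<xi>\<^sub>k\<^sup>t = 0\<close> is a linear relation among the vectors \<open>\<xi>\<^sub>k\<close>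
  with coefficients \<open>a\<^sub>k (\<xi>\<^sub>k)\<^sub>j = \<plusminus>a\<^sub>k\<close>. Hence the rank-one matrices are even linearly
  independent.
\<close>

lemma schur_independent_imp_simplex:
  fixes \<xi> :: "nat \<Rightarrow> real ^ 'n"
  assumes indep: "schur_independent r \<xi>" and sgn: "sign_vectors r \<xi>" and r: "1 \<le> r"
  shows "(int r - 1) simplex (convex hull ((\<lambda>k. outer (\<xi> k)) ` {1..r}))"
proof -
  let ?f = "\<lambda>k. outer (\<xi> k)"
  have lin: "a l = 0" if rel: "(\<Sum>k\<in>{1..r}. a k *\<^sub>R ?f k) = 0" and l: "l \<in> {1..r}" for a l
  proof -
    fix j :: 'n
    have "(\<Sum>k\<in>{1..r}. (a k * \<xi> k $ j) * \<xi> k $ i) = (\<Sum>k\<in>{1..r}. a k *\<^sub>R ?f k) $ i $ j" for i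
      by (simp add: outer_def mult_ac)
    then have "(\<Sum>k\<in>{1..r}. (a k * \<xi> k $ j) * \<xi> k $ i) = 0" for i
      unfolding rel by simp
    then have "a l * \<xi> l $ j = 0"
      using l by (intro schur_independent_imp_independent[OF assms, of "\<lambda>k. a k * \<xi> k $ j"]) auto
    then show "a l = 0"
      using sgn l by (auto simp: sign_vectors_def dest!: bspec[of _ _ l] spec[of _ j])
  qed
  have inj: "inj_on ?f {1..r}" by (rule independent_family_inj[OF finite_atLeastAtMost, where \<xi>="?f"]) (rule lin)
  have "\<not> affine_dependent (?f ` {1..r})"
  proof
    assume "affine_dependent (?f ` {1..r})"
    then obtain U where U: "\<exists>v\<in>?f ` {1..r}. U v \<noteq> 0" "(\<Sum>v\<in>?f ` {1..r}. U v *\<^sub>R v) = 0"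
      by (subst (asm) affine_dependent_explicit_finite) auto
    have "(\<Sum>k\<in>{1..r}. U (?f k) *\<^sub>R ?f k) = 0"
      using U(2) by (subst (asm) sum.reindex[OF inj]) (simp add: o_def)
    with lin[of "\<lambda>k. U (?f k)"] U(1) show False by auto
  qed
  moreover have "card (?f ` {1..r}) = r" using card_image[OF inj] by simp
  ultimately show ?thesis
    unfolding simplex_def by (intro exI[of _ "?f ` {1..r}"]) auto
qed

lemma schur_independent_imp_simplicial_face:
  fixes \<xi> :: "nat \<Rightarrow> real ^ 'n"
  assumes indep: "schur_independent r \<xi>" and sgn: "sign_vectors r \<xi>" and r: "1 \<le> r"
  defines "F \<equiv> convex hull ((\<lambda>k. outer (\<xi> k)) ` {1..r})"
  shows "simplicial_face F elliptope" and "aff_dim F = int r - 1"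
proof -
  have simplex: "(int r - 1) simplex F"
    unfolding F_def by (rule schur_independent_imp_simplex[OF indep sgn r])
  then show dim: "aff_dim F = int r - 1" by (rule aff_dim_simplex)
  show "simplicial_face F elliptope"
    unfolding simplicial_face_def dim
    using simplex schur_independent_imp_face[OF indep sgn r] by (simp add: F_def)
qed

section \<open>Relations vanishing at independent random points\<close>
lemma measure_bind_pmf_eq:
  "measure_pmf.prob (bind_pmf M f) E = (\<integral>x. measure_pmf.prob (f x) E \<partial>measure_pmf M)"
proof -
  have "ennreal (measure_pmf.prob (bind_pmf M f) E) = (\<integral>\<^sup>+x. ennreal (measure_pmf.prob (f x) E) \<partial>measure_pmf M)"
    by (simp add: measure_pmf.emeasure_eq_measure[symmetric])
  also have "\<dots> = ennreal (\<integral>x. measure_pmf.prob (f x) E \<partial>measure_pmf M)"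
    by (intro nn_integral_eq_integral measure_pmf.integrable_const_bound[where B=1]) auto
  finally show ?thesis
    by (simp add: integral_nonneg)
qed

definition vanishing_combination ::
  "'i set \<Rightarrow> ('i \<Rightarrow> 'x \<Rightarrow> real) \<Rightarrow> 'x set \<Rightarrow> bool" where
  "vanishing_combination I b S \<longleftrightarrow>
     (\<exists>c. (\<exists>i\<in>I. c i \<noteq> 0) \<and> (\<forall>x\<in>S. (\<Sum>i\<in>I. c i * b i x) = 0))"

text \<open>
  One step of Gaussian elimination: a combination that vanishes at \<open>y\<close> can be rewritten in
  the functions corrected by a multiple of \<open>b\<^sub>i\<close> so as to vanish at \<open>y\<close>, with \<open>b\<^sub>i\<close> itself gone.
\<close>

lemma vanishing_combination_eliminate:
  fixes b :: "'i \<Rightarrow> 'x \<Rightarrow> real"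
  assumes fin: "finite I" and i: "i \<in> I" and y: "b i y \<noteq> 0"
    and van: "vanishing_combination I b (insert y S)"
  shows "vanishing_combination (I - {i}) (\<lambda>j x. b j x - b j y / b i y * b i x) S"
proof -
  obtain c where c: "\<exists>j\<in>I. c j \<noteq> 0" "(\<Sum>j\<in>I. c j * b j y) = 0"
      "\<And>x. x \<in> S \<Longrightarrow> (\<Sum>j\<in>I. c j * b j x) = 0"
    using van by (auto simp: vanishing_combination_def)
  have split: "(\<Sum>j\<in>I. c j * b j x) = c i * b i x + (\<Sum>j\<in>I - {i}. c j * b j x)" for x
    using fin i by (rule sum.remove)
  have ci: "c i = - (\<Sum>j\<in>I - {i}. c j * b j y) / b i y"
    using c(2) split[of y] y by (simp add: field_simps)
  have "\<exists>j\<in>I - {i}. c j \<noteq> 0"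
  proof (rule ccontr)
    assume *: "\<not> ?thesis"
    then have "c i = 0" unfolding ci by (simp add: sum.neutral)
    with c(1) * show False by auto
  qed
  moreover have "(\<Sum>j\<in>I - {i}. c j * (b j x - b j y / b i y * b i x)) = 0" if "x \<in> S" for x
  proof -
    have "(\<Sum>j\<in>I - {i}. c j * (b j x - b j y / b i y * b i x))
        = (\<Sum>j\<in>I - {i}. c j * b j x) - (\<Sum>j\<in>I - {i}. c j * b j y) / b i y * b i x"
      by (simp add: right_diff_distrib sum_subtractf sum_divide_distrib sum_distrib_right mult.assoc)
    also have "\<dots> = (\<Sum>j\<in>I. c j * b j x)" unfolding split ci by simp
    finally show ?thesis using c(3) that by simp
  qed
  ultimately show ?thesis unfolding vanishing_combination_def by blast
qed

text \<open>
  Nontrivial combinations of the corrected functions are nontrivial combinations of the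
  original ones. A hypothesis about all nontrivial combinations therefore survives elimination.
\<close>

lemma eliminate_nonzero:
  fixes b :: "'i \<Rightarrow> 'x \<Rightarrow> real"
  assumes fin: "finite I" and i: "i \<in> I" and c: "\<exists>j\<in>I - {i}. c j \<noteq> 0"
  obtains c' where "\<exists>j\<in>I. c' j \<noteq> 0"
    and "\<And>x. (\<Sum>j\<in>I - {i}. c j * (b j x - t j * b i x)) = (\<Sum>j\<in>I. c' j * b j x)"
proof
  let ?c' = "c(i := - (\<Sum>j\<in>I - {i}. c j * t j))"
  show "\<exists>j\<in>I. ?c' j \<noteq> 0" using c by auto
  fix x
  have "(\<Sum>j\<in>I. ?c' j * b j x) = ?c' i * b i x + (\<Sum>j\<in>I - {i}. ?c' j * b j x)"
    using fin i by (rule sum.remove)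
  also have "(\<Sum>j\<in>I - {i}. ?c' j * b j x) = (\<Sum>j\<in>I - {i}. c j * b j x)"
    by (intro sum.cong) auto
  finally show "(\<Sum>j\<in>I - {i}. c j * (b j x - t j * b i x)) = (\<Sum>j\<in>I. ?c' j * b j x)"
    by (simp add: right_diff_distrib sum_subtractf sum_distrib_right mult.assoc)
qed

text \<open>
  Reveal the sample points one at a time. As long as \<open>d \<ge> 1\<close> functions remain, a new point
  permits an elimination with probability at least \<open>q\<close>, and then the number of functions drops
  to \<open>d - 1\<close>. The weight \<open>s ^ (1 - d)\<close>, replaced by \<open>0\<close> once \<open>d = 0\<close>, is multiplied by at most \<open>s\<close> in
  such a step and is otherwise unchanged. Its mean therefore contracts by the factor
  \<open>1 - q (1 - s)\<close> per point, and it dominates the indicator of a surviving relation.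
  Multiplying through by \<open>s ^ (d - 1)\<close> keeps the statement meaningful for \<open>s = 0\<close>.
\<close>

lemma prob_vanishing_combination:
  fixes b :: "'i \<Rightarrow> 'x \<Rightarrow> real" and Q :: "'x pmf" and A :: "'k set"
  assumes A: "finite A" and I: "finite I" and s: "0 \<le> s" "s \<le> 1"
    and q: "\<And>c. \<exists>i\<in>I. c i \<noteq> 0 \<Longrightarrow> q \<le> measure_pmf.prob Q {x. (\<Sum>i\<in>I. c i * b i x) \<noteq> 0}"
    and q01: "0 \<le> q" "q \<le> 1"
  shows "measure_pmf.prob (Pi_pmf A d (\<lambda>_. Q)) {g. vanishing_combination I b (g ` A)}
           * s ^ (card I - 1) \<le> (1 - q * (1 - s)) ^ card A"
  using A I q
proof (induction A arbitrary: I b rule: finite_induct)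
  case empty
  show ?case using s by (simp add: mult_le_one power_le_one)
next
  case (insert a A)
  define R where "R = 1 - q * (1 - s)"
  have qs: "q * (1 - s) \<le> 1 * 1" using q01 s by (intro mult_mono) auto
  then have R0: "0 \<le> R" by (simp add: R_def)
  have R1: "0 \<le> R ^ n" for n using R0 by simp
  show ?case
  proof (cases "I = {}")
    case True
    then show ?thesis using R1[of "card (insert a A)"] by (simp add: vanishing_combination_def R_def)
  next
    case False
    \<comment> \<open>The points at which some function can serve as a pivot.\<close>
    define E where "E = {y. \<exists>i\<in>I. b i y \<noteq> 0}"
    let ?bad = "{g. vanishing_combination I b (g ` insert a A)}"
    let ?N = "Pi_pmf A d (\<lambda>_. Q)"
    define h where "h y = measure_pmf.prob (map_pmf (\<lambda>g. g(a := y)) ?N) ?bad" for y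
    have img: "(g(a := y)) ` insert a A = insert y (g ` A)" for g :: "'k \<Rightarrow> 'x" and y
      using insert.hyps by (auto simp: image_def)
    have h_eq: "h y = measure_pmf.prob ?N {g. vanishing_combination I b (insert y (g ` A))}" for y
      unfolding h_def measure_map_pmf vimage_def by (simp only: mem_Collect_eq img)
    have bound: "h y * s ^ (card I - 1) \<le> R ^ card A * (1 - (1 - s) * indicator E y)" for y
    proof (cases "y \<in> E")
      case False
      have "h y \<le> measure_pmf.prob ?N {g. vanishing_combination I b (g ` A)}"
        unfolding h_eq by (rule measure_pmf.finite_measure_mono)
          (auto simp: vanishing_combination_def)
      then have "h y * s ^ (card I - 1)
          \<le> measure_pmf.prob ?N {g. vanishing_combination I b (g ` A)} * s ^ (card I - 1)"
        using s by (intro mult_right_mono) auto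
      also have "\<dots> \<le> R ^ card A"
        unfolding R_def by (rule insert.IH[OF insert.prems])
      finally show ?thesis using False by simp
    next
      case True
      then obtain i where i: "i \<in> I" "b i y \<noteq> 0" by (auto simp: E_def)
      define b' where "b' j x = b j x - b j y / b i y * b i x" for j x
      let ?P = "measure_pmf.prob ?N {g. vanishing_combination (I - {i}) b' (g ` A)}"
      have hP: "h y \<le> ?P"
        unfolding h_eq b'_def using vanishing_combination_eliminate[where b=b, OF insert.prems(1) i]
        by (intro measure_pmf.finite_measure_mono) auto
      have "h y * s ^ (card I - 1) \<le> s * R ^ card A"
      proof (cases "I = {i}")
        case True
        \<comment> \<open>No function is left, hence no relation; here the exponent cannot decrease further.\<close>
        then have "?P = 0" by (simp add: vanishing_combination_def)
        then have "h y = 0" using hP by (simp add: h_def measure_le_0_iff)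
        then show ?thesis using s R1 by simp
      next
        case False
        then have ne: "I - {i} \<noteq> {}" using i by auto
        then have "card (I - {i}) > 0" using insert.prems(1) by (simp add: card_gt_0_iff)
        then have card: "card I - 1 = Suc (card (I - {i}) - 1)"
          using i insert.prems(1) by simp
        have "?P * s ^ (card (I - {i}) - 1) \<le> R ^ card A"
          unfolding R_def
        proof (rule insert.IH)
          fix c assume "\<exists>j\<in>I - {i}. c j \<noteq> (0::real)"
          then obtain c' where "\<exists>j\<in>I. c' j \<noteq> 0"
            "\<And>x. (\<Sum>j\<in>I - {i}. c j * b' j x) = (\<Sum>j\<in>I. c' j * b j x)"
            unfolding b'_def by (rule eliminate_nonzero[OF insert.prems(1) i(1), where b=b and t="\<lambda>j. b j y / b i y"]) blast+
          then show "q \<le> measure_pmf.prob Q {x. (\<Sum>j\<in>I - {i}. c j * b' j x) \<noteq> 0}"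
            using insert.prems(2)[of c'] by simp
        qed (use insert.prems in auto)
        then have "s * (?P * s ^ (card (I - {i}) - 1)) \<le> s * R ^ card A"
          using s by (intro mult_left_mono)
        moreover have "h y * s ^ (card I - 1) \<le> ?P * s ^ (card I - 1)"
          using hP s by (intro mult_right_mono) auto
        ultimately show ?thesis unfolding card by (simp add: mult_ac)
      qed
      then show ?thesis using True by (simp add: mult_ac)
    qed
    have PE: "q \<le> measure_pmf.prob Q E"
    proof -
      from False obtain i where i: "i \<in> I" by auto
      let ?c = "\<lambda>j. if j = i then 1 else (0::real)"
      have "q \<le> measure_pmf.prob Q {x. (\<Sum>j\<in>I. ?c j * b j x) \<noteq> 0}"
        by (rule insert.prems(2)) (use i in auto)
      also have "\<dots> \<le> measure_pmf.prob Q E"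
        using insert.prems(1) i
        by (intro measure_pmf.finite_measure_mono)
           (auto simp: E_def if_distrib[of "\<lambda>c. c * _"] cong: if_cong)
      finally show ?thesis .
    qed
    have "measure_pmf.prob (Pi_pmf (insert a A) d (\<lambda>_. Q)) ?bad = (\<integral>y. h y \<partial>measure_pmf Q)"
      unfolding Pi_pmf_insert'[OF insert.hyps] h_def measure_bind_pmf_eq[symmetric]
      by (simp add: map_pmf_def)
    then have "measure_pmf.prob (Pi_pmf (insert a A) d (\<lambda>_. Q)) ?bad * s ^ (card I - 1)
        = (\<integral>y. h y * s ^ (card I - 1) \<partial>measure_pmf Q)" by simp
    also have "\<dots> \<le> (\<integral>y. R ^ card A * (1 - (1 - s) * indicator E y) \<partial>measure_pmf Q)"
    proof (rule integral_mono)
      show "integrable (measure_pmf Q) (\<lambda>y. h y * s ^ (card I - 1))"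
        by (intro integrable_mult_left measure_pmf.integrable_const_bound[where B=1]) (auto simp: h_def)
      show "integrable (measure_pmf Q) (\<lambda>y. R ^ card A * (1 - (1 - s) * indicator E y))"
        using s by (intro integrable_mult_right measure_pmf.integrable_const_bound[where B=1])
          (auto simp: indicator_def)
    qed (rule bound)
    also have "\<dots> = R ^ card A * (1 - (1 - s) * measure_pmf.prob Q E)"
    proof -
      have "integrable (measure_pmf Q) (\<lambda>y. (1 - s) * indicator E y)"
        by (intro integrable_mult_right measure_pmf.integrable_const_bound[where B=1])
          (auto simp: indicator_def)
      then show ?thesis by (simp add: Bochner_Integration.integral_diff)
    qed
    also have "\<dots> \<le> R ^ card A * R"
      using mult_left_mono[OF PE, of "1 - s"] s
      by (intro mult_left_mono R1) (simp add: R_def mult.commute)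
    finally show ?thesis using insert.hyps by (simp add: R_def mult.commute)
  qed
qed

section \<open>Quadratic forms in random signs\<close>
lemma pmf_SBern:
  assumes "0 < p" "p < 1"
  shows "pmf (SBern p) 1 = p" and "pmf (SBern p) (-1) = 1 - p"
    and "set_pmf (SBern p) = {1, -1}"
proof -
  let ?f = "\<lambda>b. if b then 1 else (-1::real)"
  have inj: "inj ?f" by (auto simp: inj_def)
  show "pmf (SBern p) 1 = p" "pmf (SBern p) (-1) = 1 - p"
    using pmf_map_inj'[OF inj, of "bernoulli_pmf p" True]
      pmf_map_inj'[OF inj, of "bernoulli_pmf p" False] assms
    by (simp_all add: SBern_def)
  show "set_pmf (SBern p) = {1, -1}"
    using assms by (auto simp: SBern_def set_pmf_bernoulli)
qed

lemma pmf_SBern_ge: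
  assumes "0 < p" "p < 1" "e \<in> {1, -1}"
  shows "p * (1 - p) \<le> pmf (SBern p) e"
proof -
  have "p * (1 - p) \<le> p * 1" "p * (1 - p) \<le> 1 * (1 - p)"
    using assms by (intro mult_mono; simp)+
  then show ?thesis using assms pmf_SBern by auto
qed

abbreviation sign_row :: "real \<Rightarrow> nat \<Rightarrow> (nat \<Rightarrow> real) pmf" where
  "sign_row p r \<equiv> Pi_pmf {1..r} 0 (\<lambda>_. SBern p)"

text \<open>
  The joint law of an array of independent identically distributed entries is the same
  whether the array is generated by columns or by rows: both mass functions are the same
  double product.
\<close>

lemma random_columns_eq_random_rows:
  "Pi_pmf {1..r} 0 (\<lambda>_. SBern_vec p :: (real ^ 'n) pmf)
     = map_pmf (\<lambda>g (k::nat). \<chi> i. g i k)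
         (Pi_pmf UNIV d (\<lambda>_. sign_row p r))"
    (is "?L = map_pmf ?T ?R")
proof (rule pmf_eqI)
  fix \<xi> :: "nat \<Rightarrow> real ^ 'n"
  have injT: "inj ?T"
    by (auto simp: inj_def fun_eq_iff vec_eq_iff)
  have injV: "inj (vec_lambda :: ('n \<Rightarrow> real) \<Rightarrow> _)"
    by (rule injI) (simp add: vec_lambda_inject)
  define g where "g i k = \<xi> k $ i" for i k
  have \<xi>: "\<xi> = ?T g" by (simp add: fun_eq_iff vec_eq_iff g_def)
  have vec: "pmf (SBern_vec p) (\<xi> k) = (\<Prod>i\<in>UNIV. pmf (SBern p) (g i k))" for k
    using pmf_map_inj'[OF injV, of "Pi_pmf UNIV 0 (\<lambda>_. SBern p)" "\<lambda>i. g i k"]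
    by (simp add: SBern_vec_def \<xi> pmf_Pi)
  have R: "pmf (map_pmf ?T ?R) \<xi> = pmf ?R g"
    unfolding \<xi> by (rule pmf_map_inj'[OF injT])
  show "pmf ?L \<xi> = pmf (map_pmf ?T ?R) \<xi>"
  proof (cases "\<forall>k. k \<notin> {1..r} \<longrightarrow> \<xi> k = 0")
    case True
    then have "\<forall>i k. k \<notin> {1..r} \<longrightarrow> g i k = 0" by (simp add: g_def)
    then have "pmf ?R g = (\<Prod>i\<in>UNIV. \<Prod>k\<in>{1..r}. pmf (SBern p) (g i k))"
      by (simp add: pmf_Pi)
    also have "\<dots> = (\<Prod>k\<in>{1..r}. \<Prod>i\<in>UNIV. pmf (SBern p) (g i k))"
      by (rule prod.swap)
    finally have "pmf ?R g = (\<Prod>k\<in>{1..r}. pmf (SBern_vec p) (\<xi> k))"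
      by (simp only: vec)
    then show ?thesis unfolding R using True by (simp add: pmf_Pi)
  next
    case False
    then obtain k i where "k \<notin> {1..r}" "g i k \<noteq> 0"
      by (auto simp: g_def vec_eq_iff)
    then have zero: "pmf (Pi_pmf {1..r} 0 (\<lambda>_. SBern p)) (g i) = 0"
      by (intro pmf_Pi_outside) auto
    have "pmf ?R g = (\<Prod>i\<in>UNIV. pmf (Pi_pmf {1..r} 0 (\<lambda>_. SBern p)) (g i))"
      by (rule pmf_Pi') auto
    also have "\<dots> = 0" using zero by (intro prod_zero) auto
    finally have "pmf ?R g = 0" .
    then show ?thesis unfolding R using False by (auto simp: pmf_Pi)
  qed
qed

lemma set_sign_row:
  assumes "0 < p" "p < 1"
    and "x \<in> set_pmf (sign_row p r)" "k \<in> {1..r}"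
  shows "x k = 1 \<or> x k = -1"
  using assms by (auto simp: set_Pi_pmf PiE_dflt_def pmf_SBern(3))

definition quadratic :: "nat \<Rightarrow> (nat \<times> nat \<Rightarrow> real) \<Rightarrow> (nat \<Rightarrow> real) \<Rightarrow> real" where
  "quadratic r c x = (\<Sum>m\<in>monomials r. c m * (x (fst m) * x (snd m)))"

lemma card_monomials: "card (monomials r) = r * (r - 1) div 2 + 1"
proof -
  have "card (pairs r) = (\<Sum>l\<in>{1..r}. card {1..<l})"
    unfolding pairs_def by (simp add: card_SigmaI)
  also have "\<dots> = (\<Sum>l\<in>{1..r}. l - 1)" by simp
  also have "\<dots> = r * (r - 1) div 2"
  proof (induction r)
    case (Suc r)
    have "Suc r * (Suc r - 1) = r * (r - 1) + r * 2" by (cases r) auto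
    then show ?case using Suc by simp
  qed simp
  finally have "card (pairs r) = r * (r - 1) div 2" .
  moreover have "(1, 1) \<notin> pairs r" by (auto simp: pairs_def)
  ultimately show ?thesis by (simp add: monomials_def)
qed

text \<open>
  The mixed second difference in two coordinates kills every monomial except their product.
\<close>

lemma quadratic_second_difference:
  assumes l: "(l, k) \<in> pairs r"
  shows "quadratic r c (x(l := 1, k := 1)) - quadratic r c (x(l := 1, k := -1))
       - quadratic r c (x(l := -1, k := 1)) + quadratic r c (x(l := -1, k := -1))
       = 4 * c (l, k)"
proof -
  have lk: "l \<noteq> k" "k < l" using l by (auto simp: pairs_def)
  let ?D = "\<lambda>m. c m * ((x(l := 1, k := 1)) (fst m) * (x(l := 1, k := 1)) (snd m))
     - c m * ((x(l := 1, k := -1)) (fst m) * (x(l := 1, k := -1)) (snd m))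
     - c m * ((x(l := -1, k := 1)) (fst m) * (x(l := -1, k := 1)) (snd m))
     + c m * ((x(l := -1, k := -1)) (fst m) * (x(l := -1, k := -1)) (snd m))"
  have D: "?D m = (if m = (l, k) then 4 * c (l, k) else 0)" if "m \<in> monomials r" for m
    using that lk by (cases m) (auto simp: monomials_def pairs_def)
  have "(\<Sum>m\<in>monomials r. ?D m) = (\<Sum>m\<in>monomials r. if m = (l, k) then 4 * c (l, k) else 0)"
    by (rule sum.cong[OF refl D])
  also have "\<dots> = 4 * c (l, k)" using l by (simp add: monomials_def)
  finally show ?thesis
    unfolding quadratic_def by (simp only: sum.distrib sum_subtractf)
qed

lemma quadratic_const:
  assumes "\<And>m. m \<in> pairs r \<Longrightarrow> c m = 0" "x 1 = 1 \<or> x 1 = -1"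
  shows "quadratic r c x = c (1, 1)"
proof -
  have "(1, 1) \<notin> pairs r" by (auto simp: pairs_def)
  then show ?thesis using assms by (auto simp: quadratic_def monomials_def sum.neutral)
qed

lemma prob_const_quadratic:
  assumes "0 < p" "p < 1" "1 \<le> r" "\<And>m. m \<in> pairs r \<Longrightarrow> c m = 0" "\<exists>m\<in>monomials r. c m \<noteq> 0"
  shows "measure_pmf.prob (sign_row p r) {x. quadratic r c x \<noteq> 0} = 1"
proof -
  have "c (1, 1) \<noteq> 0" using assms(4,5) by (auto simp: monomials_def)
  moreover have "quadratic r c x = c (1, 1)" if "x \<in> set_pmf (sign_row p r)" for x
    using set_sign_row[OF assms(1,2) that, of 1] assms(3) by (intro quadratic_const assms(4)) auto
  ultimately show ?thesis
    by (subst measure_pmf.prob_eq_1) (auto simp: AE_measure_pmf_iff)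
qed

text \<open>
  If some off-diagonal coefficient is nonzero, fix all signs other than the two involved. By
  the second difference, one of the four remaining sign patterns gives a nonzero value, and
  each pattern has probability at least \<open>(p (1 - p))\<^sup>2\<close>.
\<close>

lemma prob_quadratic_nonzero:
  assumes p: "0 < p" "p < 1" and r: "1 \<le> r" and c: "\<exists>m\<in>monomials r. c m \<noteq> 0"
  shows "p\<^sup>2 * (1 - p)\<^sup>2 \<le> measure_pmf.prob (sign_row p r) {x. quadratic r c x \<noteq> 0}"
proof (cases "\<forall>m\<in>pairs r. c m = 0")
  case True
  have "p * (1 - p) \<le> 1 * 1" using p by (intro mult_mono) auto
  then have "(p * (1 - p))\<^sup>2 \<le> 1" using p by (intro power_le_one) auto
  then show ?thesis
    using prob_const_quadratic[OF p r _ c] True by (simp add: power_mult_distrib)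
next
  case False
  then obtain l k where lk: "(l, k) \<in> pairs r" "c (l, k) \<noteq> 0" by auto
  define B where "B = {1..r} - {l, k}"
  have ins: "{1..r} = insert k (insert l B)" "k \<notin> insert l B" "l \<notin> B" "finite B"
    using lk(1) by (auto simp: B_def pairs_def)
  let ?E = "{x. quadratic r c x \<noteq> 0}"
  let ?S = "SBern p"
  let ?N = "Pi_pmf B 0 (\<lambda>_. ?S)"
  have row: "sign_row p r = bind_pmf ?N (\<lambda>x. map_pmf (\<lambda>(e, e'). x(l := e, k := e')) (pair_pmf ?S ?S))"
  proof -
    let ?ret = "\<lambda>x e e'. return_pmf (x(l := e, k := e'))"
    have "sign_row p r
        = bind_pmf ?S (\<lambda>e'. bind_pmf ?S (\<lambda>e. bind_pmf ?N (\<lambda>x. ?ret x e e')))"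
      unfolding ins(1) using ins(2-4)
      by (simp add: Pi_pmf_insert' bind_assoc_pmf bind_return_pmf)
    also have "\<dots> = bind_pmf ?S (\<lambda>e'. bind_pmf ?N (\<lambda>x. bind_pmf ?S (\<lambda>e. ?ret x e e')))"
      by (rule bind_pmf_cong[OF refl], rule bind_commute_pmf)
    also have "\<dots> = bind_pmf ?N (\<lambda>x. bind_pmf ?S (\<lambda>e'. bind_pmf ?S (\<lambda>e. ?ret x e e')))"
      by (rule bind_commute_pmf)
    also have "\<dots> = bind_pmf ?N (\<lambda>x. bind_pmf ?S (\<lambda>e. bind_pmf ?S (\<lambda>e'. ?ret x e e')))"
      by (rule bind_pmf_cong[OF refl], rule bind_commute_pmf)
    finally show ?thesis
      by (simp add: pair_pmf_def map_pmf_def bind_assoc_pmf bind_return_pmf)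
  qed
  have cond: "p\<^sup>2 * (1 - p)\<^sup>2 \<le> measure_pmf.prob (map_pmf (\<lambda>(e, e'). x(l := e, k := e')) (pair_pmf ?S ?S)) ?E"
    for x
  proof -
    obtain e e' where e: "e \<in> {1, -1}" "e' \<in> {1, -1}" "quadratic r c (x(l := e, k := e')) \<noteq> 0"
    proof -
      have "\<exists>e\<in>{1, -1}. \<exists>e'\<in>{1, -1}. quadratic r c (x(l := e, k := e')) \<noteq> 0"
      proof (rule ccontr)
        assume "\<not> ?thesis"
        then show False using quadratic_second_difference[OF lk(1), of c x] lk(2) by simp
      qed
      then show ?thesis using that by blast
    qed
    have "p\<^sup>2 * (1 - p)\<^sup>2 = (p * (1 - p)) * (p * (1 - p))"
      by (simp add: power2_eq_square)
    also have "\<dots> \<le> pmf ?S e * pmf ?S e'"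
      using p e by (intro mult_mono pmf_SBern_ge) auto
    also have "\<dots> = measure_pmf.prob (pair_pmf ?S ?S) {(e, e')}"
      by (simp add: measure_pmf_single pmf_pair)
    also have "\<dots> \<le> measure_pmf.prob (map_pmf (\<lambda>(e, e'). x(l := e, k := e')) (pair_pmf ?S ?S)) ?E"
      using e(3) by (simp add: vimage_def) (intro measure_pmf.finite_measure_mono, auto)
    finally show ?thesis .
  qed
  have "p\<^sup>2 * (1 - p)\<^sup>2 = (\<integral>x. p\<^sup>2 * (1 - p)\<^sup>2 \<partial>measure_pmf ?N)" by simp
  also have "\<dots> \<le> (\<integral>x. measure_pmf.prob (map_pmf (\<lambda>(e, e'). x(l := e, k := e')) (pair_pmf ?S ?S)) ?E \<partial>measure_pmf ?N)"
    by (rule integral_mono) (auto intro!: measure_pmf.integrable_const_bound[where B=1] cond simp del: measure_map_pmf)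
  finally show ?thesis unfolding row measure_bind_pmf_eq .
qed

text \<open>
  A quadratic form takes equal values at \<open>x\<close> and \<open>- x\<close>, which for two signs makes
  nonvanishing occur at two sample points at once and so doubles the bound. This factor
  pays for the exponent in the case of two vertices.
\<close>

lemma prob_quadratic_nonzero_two:
  assumes p: "0 < p" "p < 1" and c: "\<exists>m\<in>monomials 2. c m \<noteq> 0"
  shows "2 * (p\<^sup>2 * (1 - p)\<^sup>2) \<le> measure_pmf.prob (sign_row p 2) {x. quadratic 2 c x \<noteq> 0}"
proof -
  let ?M = "sign_row p 2" and ?E = "{x. quadratic 2 c x \<noteq> 0}"
  have pairs2: "pairs 2 = {(2, 1)}" by (auto simp: pairs_def)
  have I2: "{1..2::nat} = {1, 2}" by auto
  define pt where "pt e e' k = (if k = 1 then e else if k = 2 then e' else 0)"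
    for e e' :: real and k :: nat
  have quad: "quadratic 2 c (pt e e') = c (1, 1) * (e * e) + c (2, 1) * (e' * e)" for e e'
    by (simp add: quadratic_def monomials_def pairs2 pt_def)
  obtain e where e: "e \<in> {1, -1}" "c (1, 1) + c (2, 1) * e \<noteq> 0"
  proof (cases "c (1, 1) + c (2, 1) * 1 = 0")
    case True
    then have "c (1, 1) + c (2, 1) * (-1) \<noteq> 0"
      using c by (auto simp: monomials_def pairs2)
    then show ?thesis using that by blast
  qed (use that in blast)
  have ne: "pt 1 e \<noteq> pt (-1) (-e)" by (auto simp: pt_def dest!: fun_cong[where x=1])
  have "p\<^sup>2 * (1 - p)\<^sup>2 \<le> pmf ?M (pt d e')" if "d \<in> {1, -1}" "e' \<in> {1, -1}" for d e'
  proof -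
    have "p\<^sup>2 * (1 - p)\<^sup>2 = (p * (1 - p)) * (p * (1 - p))"
      by (simp add: power2_eq_square)
    also have "\<dots> \<le> pmf (SBern p) d * pmf (SBern p) e'"
      using p that by (intro mult_mono pmf_SBern_ge) auto
    also have "\<dots> = pmf ?M (pt d e')"
      unfolding I2 by (subst pmf_Pi') (auto simp: pt_def)
    finally show ?thesis .
  qed
  from this[of 1 e] this[of "-1" "-e"] e
  have "2 * (p\<^sup>2 * (1 - p)\<^sup>2) \<le> (\<Sum>x\<in>{pt 1 e, pt (-1) (-e)}. pmf ?M x)"
    using ne by auto
  also have "\<dots> = measure_pmf.prob ?M {pt 1 e, pt (-1) (-e)}"
    by (rule measure_measure_pmf_finite[symmetric]) simp
  also have "\<dots> \<le> measure_pmf.prob ?M ?E"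
    using e(2) by (intro measure_pmf.finite_measure_mono) (auto simp: quad)
  finally show ?thesis .
qed

section \<open>The probability bound\<close>

text \<open>
  With \<open>x = 4 / r\<^sup>2\<close> and \<open>N = r (r - 1) / 2\<close>, the estimate \<open>1 / (1 - x) \<le> exp (x / (1 - x))\<close> bounds
  \<open>(1 - x) ^ (- N)\<close> by \<open>exp (2 r (r - 1) / (r\<^sup>2 - 4))\<close>, where the exponent is at most \<open>2\<close> from \<open>r = 4\<close>
  on, and \<open>exp 2 \<le> 16 \<le> r\<^sup>2\<close>. For \<open>r = 3\<close> the claim is \<open>9 (5/9)\<^sup>3 \<ge> 1\<close>.
\<close>

lemma geometric_budget:
  assumes r: "3 \<le> r"
  shows "1 \<le> (real r)\<^sup>2 * (1 - 4 / (real r)\<^sup>2) ^ (r * (r - 1) div 2)"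
proof (cases "r = 3")
  case True
  then show ?thesis by (simp add: power_divide power3_eq_cube)
next
  case False
  then have r4: "4 \<le> r" using r by simp
  define x where "x = 4 / (real r)\<^sup>2"
  define N where "N = r * (r - 1) div 2"
  have r16: "16 \<le> (real r)\<^sup>2" using power_mono[of 4 "real r" 2] r4 by simp
  have x: "0 < x" "x < 1" using r16 r4 by (auto simp: x_def divide_less_eq)
  have N: "2 * real N = real r * (real r - 1)"
  proof -
    have "even (r * (r - 1))" by auto
    then have "2 * N = r * (r - 1)" by (simp add: N_def)
    then have "real (2 * N) = real (r * (r - 1))" by simp
    then show ?thesis using r4 by (simp add: of_nat_diff)
  qed
  have "1 / (1 - x) = 1 + x / (1 - x)" using x by (simp add: field_simps)
  also have "\<dots> \<le> exp (x / (1 - x))" by (rule exp_ge_add_one_self)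
  finally have "(1 / (1 - x)) ^ N \<le> exp (x / (1 - x)) ^ N"
    using x by (intro power_mono) auto
  also have "\<dots> = exp (real N * (x / (1 - x)))" by (rule exp_of_nat_mult[symmetric])
  also have "\<dots> \<le> exp 2"
  proof -
    have "x / (1 - x) = 4 / ((real r)\<^sup>2 - 4)" using r16 r4 by (simp add: x_def field_simps)
    then have "real N * (x / (1 - x)) = 2 * (2 * real N) / ((real r)\<^sup>2 - 4)" by simp
    also have "\<dots> \<le> 2"
      unfolding N using r16 r4 by (simp add: field_simps power2_eq_square)
    finally show ?thesis by simp
  qed
  also have "exp 2 \<le> (16::real)"
  proof -
    have "exp (1::real) * exp 1 \<le> 4 * 4"
      using exp_le by (intro mult_mono) auto
    then show ?thesis by (simp add: exp_add[symmetric])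
  qed
  also note r16
  finally show ?thesis
    unfolding x_def[symmetric] N_def[symmetric] using x by (simp add: power_divide field_simps)
qed

text \<open>
  The elimination bound with \<open>r (r - 1) / 2 + 1\<close> functions. For \<open>r \<ge> 3\<close> the choice
  \<open>s = 1 - 4 / r\<^sup>2\<close> produces exactly the exponent \<open>4 u / r\<^sup>2\<close>, where \<open>u = p\<^sup>2 (1 - p)\<^sup>2\<close>, at a cost
  \<open>s ^ (- r (r - 1) / 2)\<close> that the factor \<open>r\<^sup>2\<close> covers. This \<open>s\<close> vanishes for \<open>r = 2\<close> and is negative
  for \<open>r = 1\<close>, so these cases use larger escape probabilities with \<open>s = 1/2\<close> and \<open>s = 0\<close>.
\<close>

lemma prob_vanishing_quadratic:
  fixes p :: real
  assumes p: "0 < p" "p < 1" and r: "1 \<le> r"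
  shows "measure_pmf.prob (Pi_pmf (UNIV :: 'n::finite set) d (\<lambda>_. sign_row p r))
           {g. vanishing_combination (monomials r) (\<lambda>m x. x (fst m) * x (snd m)) (range g)}
         \<le> (real r)\<^sup>2 * exp (- 4 * p\<^sup>2 * (1 - p)\<^sup>2 * real CARD('n) / (real r)\<^sup>2)"
    (is "?P \<le> _")
proof -
  define u where "u = p\<^sup>2 * (1 - p)\<^sup>2"
  let ?n = "CARD('n)"
  have u0: "0 \<le> u" by (simp add: u_def)
  have u1: "4 * u \<le> 1"
  proof -
    have "4 * (p * (1 - p)) \<le> 1"
      using zero_le_power2[of "2 * p - 1"] by (simp add: power2_eq_square algebra_simps)
    then have "p * (1 - p) \<le> 1/4" by simp
    then have "(p * (1 - p))\<^sup>2 \<le> (1/4)\<^sup>2" using p by (intro power_mono) auto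
    moreover have "(p * (1 - p))\<^sup>2 = u" by (simp add: u_def power_mult_distrib)
    ultimately show ?thesis by (simp add: power2_eq_square)
  qed
  have main: "?P * s ^ (r * (r - 1) div 2) \<le> exp (- (q * (1 - s)) * ?n)"
    if s: "0 \<le> s" "s \<le> 1" and q: "0 \<le> q" "q \<le> 1"
      and escape: "\<And>c. \<exists>m\<in>monomials r. c m \<noteq> 0 \<Longrightarrow>
        q \<le> measure_pmf.prob (sign_row p r) {x. quadratic r c x \<noteq> 0}" for s q
  proof -
    have "?P * s ^ (card (monomials r) - 1) \<le> (1 - q * (1 - s)) ^ ?n"
      by (rule prob_vanishing_combination) (use s q escape in \<open>auto simp: quadratic_def\<close>)
    also have "\<dots> \<le> exp (- (q * (1 - s))) ^ ?n"
    proof (rule power_mono)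
      show "1 - q * (1 - s) \<le> exp (- (q * (1 - s)))"
        using exp_ge_add_one_self[of "- (q * (1 - s))"] by simp
      have "q * (1 - s) \<le> 1 * 1" using s q by (intro mult_mono) auto
      then show "0 \<le> 1 - q * (1 - s)" by simp
    qed
    also have "\<dots> = exp (- (q * (1 - s)) * ?n)"
      by (simp add: exp_of_nat_mult[symmetric] mult.commute)
    finally show ?thesis by (simp add: card_monomials)
  qed
  consider "r = 1" | "r = 2" | "3 \<le> r" using r by linarith
  then have "?P \<le> (real r)\<^sup>2 * exp (- (4 * u / (real r)\<^sup>2) * ?n)"
  proof cases
    case 1
    have "pairs 1 = {}" by (auto simp: pairs_def)
    then have "?P * 0 ^ (r * (r - 1) div 2) \<le> exp (- ((4 * u) * (1 - 0)) * ?n)"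
    proof (intro main)
      fix c assume "\<exists>m\<in>monomials r. c m \<noteq> (0::real)"
      with prob_const_quadratic[OF p r, of c] \<open>pairs 1 = {}\<close> 1 u1
      show "4 * u \<le> measure_pmf.prob (sign_row p r) {x. quadratic r c x \<noteq> 0}" by simp
    qed (use u0 u1 in auto)
    then show ?thesis using 1 by simp
  next
    case 2
    have "?P * (1/2) ^ (r * (r - 1) div 2) \<le> exp (- ((2 * u) * (1 - 1/2)) * ?n)"
    proof (intro main)
      fix c assume "\<exists>m\<in>monomials r. c m \<noteq> (0::real)"
      then show "2 * u \<le> measure_pmf.prob (sign_row p r) {x. quadratic r c x \<noteq> 0}"
        unfolding 2 u_def by (rule prob_quadratic_nonzero_two[OF p])
    qed (use u0 u1 in auto)
    then have "?P \<le> 2 * exp (- u * ?n)" using 2 by simp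
    also have "\<dots> \<le> 4 * exp (- u * ?n)" by (intro mult_right_mono) auto
    finally show ?thesis using 2 by simp
  next
    case 3
    define s where "s = 1 - 4 / (real r)\<^sup>2"
    have r9: "9 \<le> (real r)\<^sup>2" using power_mono[of 3 "real r" 2] 3 by simp
    have s: "0 < s" "s \<le> 1" using r9 by (auto simp: s_def divide_less_eq)
    have "?P * s ^ (r * (r - 1) div 2) \<le> exp (- (u * (1 - s)) * ?n)"
    proof (intro main)
      fix c assume "\<exists>m\<in>monomials r. c m \<noteq> (0::real)"
      then show "u \<le> measure_pmf.prob (sign_row p r) {x. quadratic r c x \<noteq> 0}"
        unfolding u_def by (rule prob_quadratic_nonzero[OF p r])
    qed (use u0 u1 s in auto)
    then have "(real r)\<^sup>2 * (?P * s ^ (r * (r - 1) div 2)) \<le> (real r)\<^sup>2 * exp (- (4 * u / (real r)\<^sup>2) * ?n)"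
      by (intro mult_left_mono) (auto simp: s_def mult.commute)
    moreover have "?P * 1 \<le> ?P * ((real r)\<^sup>2 * s ^ (r * (r - 1) div 2))"
      unfolding s_def by (intro mult_left_mono geometric_budget 3) auto
    ultimately show ?thesis by (simp add: mult_ac)
  qed
  then show ?thesis by (simp add: u_def mult_ac)
qed

section \<open>Random faces\<close>

theorem theorem2p10:
  fixes p :: real and r :: nat
  assumes "0 < p" and "p < 1" and "1 \<le> r"
  shows "measure_pmf.prob (random_face p r)
           {F :: (real ^ 'n ^ 'n) set. simplicial_face F elliptope \<and> aff_dim F = int r - 1}
         \<ge> 1 - (real r)\<^sup>2 * exp (- 4 * p\<^sup>2 * (1 - p)\<^sup>2 * real CARD('n) / (real r)\<^sup>2)"
proof -
  define d :: "nat \<Rightarrow> real" where "d = (\<lambda>_. 0)"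
  let ?rows = "Pi_pmf (UNIV :: 'n set) d (\<lambda>_. sign_row p r)"
  let ?T = "\<lambda>(g :: 'n \<Rightarrow> nat \<Rightarrow> real) k. (\<chi> i. g i k) :: real ^ 'n"
  let ?F = "\<lambda>\<xi>. convex hull ((\<lambda>k. outer (\<xi> k)) ` {1..r})"
  let ?good = "{F :: (real ^ 'n ^ 'n) set. simplicial_face F elliptope \<and> aff_dim F = int r - 1}"
  let ?bad = "{g. vanishing_combination (monomials r) (\<lambda>m x. x (fst m) * x (snd m)) (range g)}"
  have face: "random_face p r = map_pmf (\<lambda>g. ?F (?T g)) ?rows"
    unfolding random_face_def random_columns_eq_random_rows[where d=d] by (simp add: map_pmf_comp)
  have good: "?F (?T g) \<in> ?good" if g: "g \<in> set_pmf ?rows" and nb: "g \<notin> ?bad" for g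
  proof -
    have "g i \<in> set_pmf (sign_row p r)" for i
      using g by (auto simp: set_Pi_pmf PiE_dflt_def)
    then have "sign_vectors r (?T g)"
      using set_sign_row[OF assms(1,2)] by (auto simp only: sign_vectors_def vec_lambda_beta)
    moreover have "schur_independent r (?T g)"
      using nb by (auto simp: schur_independent_def vanishing_combination_def)
    ultimately show ?thesis
      using schur_independent_imp_simplicial_face[of r "?T g"] assms(3) by blast
  qed
  have "1 - measure_pmf.prob ?rows ?bad = measure_pmf.prob ?rows (- ?bad)"
    by (subst measure_pmf.prob_compl[symmetric]) (auto simp: Compl_eq_Diff_UNIV)
  also have "\<dots> \<le> measure_pmf.prob ?rows ((\<lambda>g. ?F (?T g)) -` ?good)"
    by (rule measure_pmf.finite_measure_mono_AE) (use good in \<open>auto simp: AE_measure_pmf_iff\<close>)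
  also have "\<dots> = measure_pmf.prob (random_face p r) ?good"
    by (simp add: face)
  finally show ?thesis
    using prob_vanishing_quadratic[OF assms, where 'n='n and d=d] by linarith
qed

end
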